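(* Let $G=(V,E)$ be a directed acyclic graph with a single sink $z$. If there is a black pebbling strategy of $G$ with time $t$ and space $s$, then there is a Monomial Calculus (MC) refutation of (the polynomial encoding of) $\mathrm{Peb}(G)$ with degree $s$ and size $ts$. Moreover, the variable space of this refutation coincides with its degree.
   Context: Black pebbling: for a DAG $G=(V,E)$ with unique sink $z$, a black pebbling is a sequence of sets (configurations) $B_0,B_1,\dots,B_t\subseteq V$ with $B_0=B_t=\emptyset$, $z\in B_i$ for some $i$, and each $B_j$ obtained from $B_{j-1}$ either by placing a pebble on a vertex $v\notin B_{j-1}$ all of whose direct predecessors $\mathrm{pred}(v)$ lie in $B_{j-1}$ (so sources can always be pebbled), i.e. $B_j=B_{j-1}\cup\{v\}$, or by removing any pebble, $B_j=B_{j-1}\setminus\{v\}$. Its time is $t$ and its space is $\max_j |B_j|$. Pebbling formula $\mathrm{Peb}(G)$: with a Boolean variable $x_v$ for each $v\in V$, it consists of the clauses $\bigvee_{u\in\mathrm{pred}(v)}\bar x_u\vee x_v$ for every $v\in V$ and the unit clause $\bar x_z$. Its polynomial encoding over a field $\mathbb F$ (true identified with $0$, false with $1$) consists of the polynomials $A_v=\big(\prod_{u\in\mathrm{pred}(v)}x_u\big)(1-x_v)$ for each $v\in V$ and $x_z$; the Boolean axioms $x_v^2-x_v$ are also available. Monomial Calculus: an MC refutation of a set of polynomials $\mathcal P$ is a sequence of polynomials ending in $1$, each of which is in $\mathcal P$, a Boolean axiom, or obtained from earlier ones by linear combination ($p,q\mapsto \alpha p+\beta q$, $\alpha,\beta\in\mathbb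 F$) or by multiplication $p\mapsto x_ip$, where $p$ must be a monomial or the product of a monomial and an axiom (an element of $\mathcal P$ or a Boolean axiom). Degree of a refutation: maximum degree of its polynomials. Size: total number of monomials in all its polynomials, fully expanded, counted with repetitions. Variable space: viewing the refutation as a sequence of configurations (sets of polynomials held in memory, starting at $\emptyset$ and ending with $\{1\}$, each step adding an axiom, erasing a polynomial, or adding a polynomial inferred by a rule), the maximum number of distinct variables appearing in a single configuration.
   Formalization: The size bound ts (read as at most ts) is false when G is the single vertex z and t = 2, s = 1: every refutation then has size at least 4 > 2. In that one case the bound is replaced by 4; in all other cases it is ts. *)

theory Defs
  imports "HOL-Library.Poly_Mapping"
begin

section \<open>Black pebbling\<close>

definition preds :: "'v rel \<Rightarrow> 'v \<Rightarrow> 'v set" where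
  "preds E v = {u. (u, v) \<in> E}"

definition dag_with_sink :: "'v set \<Rightarrow> 'v rel \<Rightarrow> 'v \<Rightarrow> bool" where
  "dag_with_sink V E z \<longleftrightarrow>
     finite V \<and> E \<subseteq> V \<times> V \<and> acyclic E \<and> {v \<in> V. \<forall>w. (v, w) \<notin> E} = {z}"

definition pebbling_move :: "'v set \<Rightarrow> 'v rel \<Rightarrow> 'v set \<Rightarrow> 'v set \<Rightarrow> bool" where
  "pebbling_move V E B B' \<longleftrightarrow>
     (\<exists>v\<in>V. v \<notin> B \<and> preds E v \<subseteq> B \<and> B' = insert v B) \<or> (\<exists>v\<in>B. B' = B - {v})"

text \<open>The strategy is \<open>B 0, \<dots>, B t\<close>; the values of \<open>B\<close> beyond \<open>t\<close> are irrelevant.\<close>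

definition black_pebbling ::
    "'v set \<Rightarrow> 'v rel \<Rightarrow> 'v \<Rightarrow> (nat \<Rightarrow> 'v set) \<Rightarrow> nat \<Rightarrow> bool" where
  "black_pebbling V E z B t \<longleftrightarrow>
     B 0 = {} \<and> B t = {} \<and> (\<exists>i\<le>t. z \<in> B i) \<and>
     (\<forall>j<t. pebbling_move V E (B j) (B (Suc j)))"

definition pebbling_space :: "(nat \<Rightarrow> 'v set) \<Rightarrow> nat \<Rightarrow> nat" where
  "pebbling_space B t = Max ((\<lambda>j. card (B j)) ` {..t})"


section \<open>Multivariate polynomials\<close>

text \<open>
  A power product is a finitely supported exponent function \<open>'v \<Rightarrow>\<^sub>0 nat\<close>, and a polynomial a
  finitely supported coefficient function on power products, with convolution as multiplication.
  Polynomials are not reduced modulo the Boolean axioms.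
\<close>

type_synonym ('v, 'f) mpoly = "('v \<Rightarrow>\<^sub>0 nat) \<Rightarrow>\<^sub>0 'f"

definition Var :: "'v \<Rightarrow> ('v, 'f::field) mpoly" where
  "Var v = Poly_Mapping.single (Poly_Mapping.single v 1) 1"

definition Const :: "'f \<Rightarrow> ('v, 'f::field) mpoly" where
  "Const c = Poly_Mapping.single 0 c"

definition is_monomial :: "('v, 'f::field) mpoly \<Rightarrow> bool" where
  "is_monomial p \<longleftrightarrow> (\<exists>m. p = Poly_Mapping.single m 1)"

definition num_monomials :: "('v, 'f::field) mpoly \<Rightarrow> nat" where
  "num_monomials p = card (Poly_Mapping.keys p)"

definition monomial_degree :: "('v \<Rightarrow>\<^sub>0 nat) \<Rightarrow> nat" where
  "monomial_degree m = (\<Sum>v\<in>Poly_Mapping.keys m. Poly_Mapping.lookup m v)"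

text \<open>The zero polynomial gets degree 0.\<close>

definition total_degree :: "('v, 'f::field) mpoly \<Rightarrow> nat" where
  "total_degree p = Max (insert 0 (monomial_degree ` Poly_Mapping.keys p))"

definition vars :: "('v, 'f::field) mpoly \<Rightarrow> 'v set" where
  "vars p = (\<Union>m\<in>Poly_Mapping.keys p. Poly_Mapping.keys m)"


section \<open>Polynomial encoding of the pebbling formula\<close>

text \<open>
  A 0/1-assignment to the variables is a root of \<open>peb_axiom E v\<close> iff some \<open>x\<^sub>u\<close> with
  \<open>u \<in> preds E v\<close> is 0 or \<open>x\<^sub>v\<close> is 1, so these polynomials encode the clauses
  \<open>(\<Or>u\<in>preds E v. \<not> x\<^sub>u) \<or> x\<^sub>v\<close>, and \<open>Var z\<close> encodes \<open>\<not> x\<^sub>z\<close>, when the value 1 of a variable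
  stands for true. A polynomial with value 0 is a satisfied constraint.
\<close>

definition peb_axiom :: "'v rel \<Rightarrow> 'v \<Rightarrow> ('v, 'f::field) mpoly" where
  "peb_axiom E v = (\<Prod>u\<in>preds E v. Var u) * (1 - Var v)"

definition Peb :: "'v set \<Rightarrow> 'v rel \<Rightarrow> 'v \<Rightarrow> ('v, 'f::field) mpoly set" where
  "Peb V E z = insert (Var z) (peb_axiom E ` V)"

definition boolean_axioms :: "'v set \<Rightarrow> ('v, 'f::field) mpoly set" where
  "boolean_axioms V = (\<lambda>v. (Var v)\<^sup>2 - Var v) ` V"


section \<open>Monomial Calculus\<close>

text \<open>
  In all of the following, \<open>V\<close> is the set of variables and \<open>P\<close> the set of polynomials that is
  refuted.
\<close>

definition mc_axioms :: "'v set \<Rightarrow> ('v, 'f::field) mpoly set \<Rightarrow> ('v, 'f) mpoly set" where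
  "mc_axioms V P = P \<union> boolean_axioms V"

definition mc_infers ::
    "'v set \<Rightarrow> ('v, 'f::field) mpoly set \<Rightarrow> ('v, 'f) mpoly set \<Rightarrow> ('v, 'f) mpoly \<Rightarrow> bool" where
  "mc_infers V P C r \<longleftrightarrow>
     (\<exists>p\<in>C. \<exists>q\<in>C. \<exists>\<alpha> \<beta>. r = Const \<alpha> * p + Const \<beta> * q) \<or>
     (\<exists>p\<in>C. \<exists>v\<in>V.
        (is_monomial p \<or> (\<exists>m a. is_monomial m \<and> a \<in> mc_axioms V P \<and> p = m * a)) \<and>
        r = Var v * p)"

definition mc_refutation ::
    "'v set \<Rightarrow> ('v, 'f::field) mpoly set \<Rightarrow> ('v, 'f) mpoly list \<Rightarrow> bool" where
  "mc_refutation V P ps \<longleftrightarrow>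
     ps \<noteq> [] \<and> last ps = 1 \<and>
     (\<forall>i<length ps. ps ! i \<in> mc_axioms V P \<or> mc_infers V P (set (take i ps)) (ps ! i))"

definition mc_degree :: "('v, 'f::field) mpoly list \<Rightarrow> nat" where
  "mc_degree ps = Max (total_degree ` set ps)"

definition mc_size :: "('v, 'f::field) mpoly list \<Rightarrow> nat" where
  "mc_size ps = (\<Sum>p\<leftarrow>ps. num_monomials p)"

text \<open>
  If the sink \<open>z\<close> is the only vertex, every refutation contains the polynomials \<open>x\<^sub>z\<close>, \<open>1 - x\<^sub>z\<close> and
  \<open>1\<close> and hence has size at least 4, while the graph has a pebbling with time 2 and space 1. This is
  the only case in which the size bound \<open>t * s\<close> fails.
\<close>

text \<open>
  For the space measure, a refutation is presented as a list of memory steps, from which both its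
  sequence of polynomials (\<open>lines\<close>) and its configurations can be read off: the configuration after
  \<open>k\<close> steps is \<open>memory (take k \<pi>)\<close>.
\<close>

datatype 'p mc_step = Add 'p | Erase 'p

fun apply_step :: "'p mc_step \<Rightarrow> 'p set \<Rightarrow> 'p set" where
  "apply_step (Add p) C = insert p C"
| "apply_step (Erase p) C = C - {p}"

definition memory :: "'p mc_step list \<Rightarrow> 'p set" where
  "memory \<pi> = fold apply_step \<pi> {}"

definition lines :: "'p mc_step list \<Rightarrow> 'p list" where
  "lines \<pi> = concat (map (\<lambda>s. case s of Add p \<Rightarrow> [p] | Erase p \<Rightarrow> []) \<pi>)"

fun mc_step_ok ::
    "'v set \<Rightarrow> ('v, 'f::field) mpoly set \<Rightarrow> ('v, 'f) mpoly set \<Rightarrow> ('v, 'f) mpoly mc_step \<Rightarrow> bool" where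
  "mc_step_ok V P C (Add p) \<longleftrightarrow> p \<in> mc_axioms V P \<or> mc_infers V P C p"
| "mc_step_ok V P C (Erase p) \<longleftrightarrow> p \<in> C"

definition mc_config_refutation ::
    "'v set \<Rightarrow> ('v, 'f::field) mpoly set \<Rightarrow> ('v, 'f) mpoly mc_step list \<Rightarrow> bool" where
  "mc_config_refutation V P \<pi> \<longleftrightarrow>
     memory \<pi> = {1} \<and> (\<forall>k<length \<pi>. mc_step_ok V P (memory (take k \<pi>)) (\<pi> ! k))"

definition mc_variable_space :: "('v, 'f::field) mpoly mc_step list \<Rightarrow> nat" where
  "mc_variable_space \<pi> =
     Max ((\<lambda>k. card (\<Union>p\<in>memory (take k \<pi>). vars p)) ` {..length \<pi>})"

end

theory Submission
  imports Defs
begin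

text \<open>
  Write \<open>m\<^sub>j\<close> for the product of the variables in \<open>B j\<close>. The refutation follows the pebbling
  backwards from the first \<open>i\<close> with \<open>z \<in> B i\<close>: it obtains \<open>m\<^sub>i\<close> as a multiple of \<open>x\<^sub>z\<close> and passes
  from \<open>m\<^sub>j\<close> to \<open>m\<^sub>j\<^sub>-\<^sub>1\<close> until it arrives at \<open>m\<^sub>0 = 1\<close>. Undoing a removal is one multiplication; undoing
  the placement of \<open>v\<close> adds the multiple \<open>m\<^sub>j\<^sub>-\<^sub>1 * (1 - x\<^sub>v)\<close> of the axiom of \<open>v\<close>. At least \<open>card (B i)\<close>
  moves remain after time \<open>i\<close>, so a budget of \<open>s * (i + card (B i))\<close> monomials is available. It
  also pays for a monomial of degree \<open>s\<close> at the start, which makes degree and variable space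
  exactly \<open>s\<close> even if the first \<open>i\<close> configurations are smaller.
\<close>

section \<open>Square-free monomials\<close>

definition set_monomial :: "'v set \<Rightarrow> ('v, 'f::field) mpoly" where
  "set_monomial A = (\<Prod>u\<in>A. Var u)"

lemma set_monomial_empty [simp]: "set_monomial {} = 1"
  by (simp add: set_monomial_def)

lemma set_monomial_insert:
  "finite A \<Longrightarrow> v \<notin> A \<Longrightarrow> set_monomial (insert v A) = Var v * set_monomial A"
  by (simp add: set_monomial_def)

text \<open>The exponent vector of \<open>set_monomial A\<close>, i.e. the indicator function of
  \<open>A\<close>. Writing it as a sum parallels the product in \<open>set_monomial\<close>, so
  that both unfold along the same induction on \<open>A\<close>.\<close>

definition exponents :: "'v set \<Rightarrow> 'v \<Rightarrow>\<^sub>0 nat" where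
  "exponents A = (\<Sum>u\<in>A. Poly_Mapping.single u 1)"

lemma lookup_exponents:
  assumes "finite A"
  shows "Poly_Mapping.lookup (exponents A) w = (if w \<in> A then 1 else 0)"
  using assms
  by (simp add: exponents_def lookup_sum lookup_single when_def)

lemma keys_exponents: "finite A \<Longrightarrow> Poly_Mapping.keys (exponents A) = A"
  by (auto simp: in_keys_iff lookup_exponents split: if_splits)

lemma exponents_insert_neq: "finite A \<Longrightarrow> v \<notin> A \<Longrightarrow> exponents A \<noteq> exponents (insert v A)"
  by (metis finite_insert insertI1 keys_exponents)

lemma set_monomial_eq_single:
  assumes "finite A"
  shows "set_monomial A = Poly_Mapping.single (exponents A) 1"
  using assms
  by (induction A) (simp_all add: set_monomial_insert exponents_def Var_def mult_single)

lemma keys_set_monomial: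
  "finite A \<Longrightarrow> Poly_Mapping.keys (set_monomial A :: ('v, 'f::field) mpoly) = {exponents A}"
  by (simp add: set_monomial_eq_single)

lemma monomial_degree_exponents: "finite A \<Longrightarrow> monomial_degree (exponents A) = card A"
  by (simp add: monomial_degree_def keys_exponents lookup_exponents)

lemma is_monomial_set_monomial: "finite A \<Longrightarrow> is_monomial (set_monomial A)"
  by (auto simp: is_monomial_def set_monomial_eq_single)

lemma vars_set_monomial [simp]: "finite A \<Longrightarrow> vars (set_monomial A :: ('v, 'f::field) mpoly) = A"
  by (simp add: vars_def keys_set_monomial keys_exponents)

lemma num_monomials_set_monomial [simp]:
  "finite A \<Longrightarrow> num_monomials (set_monomial A :: ('v, 'f::field) mpoly) = 1"
  by (simp add: num_monomials_def keys_set_monomial)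

lemma total_degree_set_monomial [simp]:
  "finite A \<Longrightarrow> total_degree (set_monomial A :: ('v, 'f::field) mpoly) = card A"
  by (simp add: total_degree_def keys_set_monomial monomial_degree_exponents)

lemma set_monomial_eq_iff:
  assumes "finite A" "finite B"
  shows "(set_monomial A :: ('v, 'f::field) mpoly) = set_monomial B \<longleftrightarrow> A = B"
  using assms vars_set_monomial by metis

text \<open>The shape of every line that is not a monomial: the axiom of \<open>v\<close> multiplied
  by some variables. For \<open>A = preds E v\<close> it is the axiom itself.\<close>

definition set_binomial :: "'v set \<Rightarrow> 'v \<Rightarrow> ('v, 'f::field) mpoly" where
  "set_binomial A v = set_monomial A * (1 - Var v)"

lemma set_binomial_eq:
  "finite A \<Longrightarrow> v \<notin> A \<Longrightarrow> set_binomial A v = set_monomial A - set_monomial (insert v A)"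
  by (simp add: set_binomial_def set_monomial_insert algebra_simps)

text \<open>The coefficients 1 and -1 are nonzero in every field, also in characteristic 2.\<close>

lemma keys_single_diff:
  assumes "a \<noteq> b"
  shows "Poly_Mapping.keys (Poly_Mapping.single a 1 - Poly_Mapping.single b (1 :: 'f::field)) = {a, b}"
  using assms
  by (auto simp: in_keys_iff lookup_minus lookup_single when_def
      simp del: lookup_not_eq_zero_eq_in_keys split: if_splits)

lemma keys_set_binomial:
  assumes "finite A" "v \<notin> A"
  shows "Poly_Mapping.keys (set_binomial A v :: ('v, 'f::field) mpoly) =
    {exponents A, exponents (insert v A)}"
  using assms
  by (simp add: set_binomial_eq set_monomial_eq_single keys_single_diff exponents_insert_neq)

lemma vars_set_binomial [simp]:
  "finite A \<Longrightarrow> v \<notin> A \<Longrightarrow> vars (set_binomial A v :: ('v, 'f::field) mpoly) = insert v A"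
  by (auto simp: vars_def keys_set_binomial keys_exponents)

lemma num_monomials_set_binomial [simp]:
  "finite A \<Longrightarrow> v \<notin> A \<Longrightarrow> num_monomials (set_binomial A v :: ('v, 'f::field) mpoly) = 2"
  by (simp add: num_monomials_def keys_set_binomial exponents_insert_neq)

lemma total_degree_set_binomial [simp]:
  "finite A \<Longrightarrow> v \<notin> A \<Longrightarrow>
    total_degree (set_binomial A v :: ('v, 'f::field) mpoly) = Suc (card A)"
  by (simp add: total_degree_def keys_set_binomial monomial_degree_exponents)

lemma set_binomial_neq_set_monomial:
  assumes "finite A" "v \<notin> A" "finite B"
  shows "(set_binomial A v :: ('v, 'f::field) mpoly) \<noteq> set_monomial B"
proof
  assume "(set_binomial A v :: ('v, 'f) mpoly) = set_monomial B"
  then have "num_monomials (set_binomial A v :: ('v, 'f) mpoly) =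
      num_monomials (set_monomial B :: ('v, 'f) mpoly)"
    by simp
  then show False
    using assms by simp
qed

lemma set_binomial_insert:
  "finite A \<Longrightarrow> a \<notin> A \<Longrightarrow> set_binomial (insert a A) v = Var a * set_binomial A v"
  by (simp add: set_binomial_def set_monomial_insert mult.assoc)

lemma peb_axiom_eq_set_binomial: "peb_axiom E v = set_binomial (preds E v) v"
  by (simp add: peb_axiom_def set_binomial_def set_monomial_def)

text \<open>Exhibits the monomial cofactor that the multiplication rule of the calculus demands for
  a premise that is not a monomial.\<close>

lemma set_binomial_multiple_of_axiom:
  assumes "finite A" "preds E v \<subseteq> A"
  shows "(set_binomial A v :: ('v, 'f::field) mpoly) =
    set_monomial (A - preds E v) * peb_axiom E v"
proof -
  have "(set_monomial A :: ('v, 'f) mpoly) = set_monomial (A - preds E v) * set_monomial (preds E v)"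
    unfolding set_monomial_def by (rule prod.subset_diff[OF assms(2,1)])
  then show ?thesis
    by (simp add: set_binomial_def peb_axiom_eq_set_binomial mult.assoc)
qed


section \<open>Derivations with bounded degree and variable space\<close>

definition config_vars :: "('v, 'f::field) mpoly set \<Rightarrow> 'v set" where
  "config_vars C = (\<Union>p\<in>C. vars p)"

text \<open>Combines legality of each step with the bound \<open>s\<close> on the degree of added
  lines and on the variables in memory after the step. The initial configuration is arbitrary, so
  that pieces can be concatenated.\<close>

fun admissible ::
    "'v set \<Rightarrow> ('v, 'f::field) mpoly set \<Rightarrow> nat \<Rightarrow> ('v, 'f) mpoly set \<Rightarrow>
      ('v, 'f) mpoly mc_step list \<Rightarrow> bool" where
  "admissible V P s C [] \<longleftrightarrow> True"
| "admissible V P s C (x # \<pi>) \<longleftrightarrow>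
     mc_step_ok V P C x \<and> (\<forall>p. x = Add p \<longrightarrow> total_degree p \<le> s) \<and>
     card (config_vars (apply_step x C)) \<le> s \<and> admissible V P s (apply_step x C) \<pi>"

lemma admissible_append:
  "admissible V P s C (\<pi> @ \<rho>) \<longleftrightarrow>
     admissible V P s C \<pi> \<and> admissible V P s (fold apply_step \<pi> C) \<rho>"
  by (induction \<pi> arbitrary: C) auto

lemma lines_simps [simp]:
  "lines [] = []"
  "lines (Add p # \<pi>) = p # lines \<pi>"
  "lines (Erase p # \<pi>) = lines \<pi>"
  "lines (\<pi> @ \<rho>) = lines \<pi> @ lines \<rho>"
  by (simp_all add: lines_def)

lemma memory_snoc [simp]: "memory (\<pi> @ [x]) = apply_step x (memory \<pi>)"
  by (simp add: memory_def)

lemma memory_Nil [simp]: "memory [] = {}"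
  by (simp add: memory_def)

section \<open>From memory configurations to sequences of lines\<close>

lemma memory_subset_lines: "memory \<pi> \<subseteq> set (lines \<pi>)"
proof (induction \<pi> rule: rev_induct)
  case (snoc x \<pi>)
  then show ?case by (cases x) auto
qed simp

lemma mc_infers_mono: "mc_infers V P C p \<Longrightarrow> C \<subseteq> D \<Longrightarrow> mc_infers V P D p"
  unfolding mc_infers_def by blast

text \<open>Erasures can be forgotten: whatever is in memory is an earlier line, and inference is
  monotone in the set of premises. The last line is a separate hypothesis because a final memory of
  \<open>{1}\<close> does not say that \<open>1\<close> was added last.\<close>

lemma mc_refutation_lines:
  fixes \<pi> :: "('v, 'f::field) mpoly mc_step list"
  assumes "mc_config_refutation V P \<pi>" "lines \<pi> \<noteq> []" "last (lines \<pi>) = 1"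
  shows "mc_refutation V P (lines \<pi>)"
proof -
  have "\<forall>k<length \<pi>. mc_step_ok V P (memory (take k \<pi>)) (\<pi> ! k)"
    using assms by (simp add: mc_config_refutation_def)
  then have "\<forall>i<length (lines \<pi>). lines \<pi> ! i \<in> mc_axioms V P \<or>
      mc_infers V P (set (take i (lines \<pi>))) (lines \<pi> ! i)"
  proof (induction \<pi> rule: rev_induct)
    case (snoc x \<pi>)
    have "mc_step_ok V P (memory (take k \<pi>)) (\<pi> ! k)" if "k < length \<pi>" for k
      using snoc.prems[rule_format, of k] that by (simp add: nth_append)
    note IH = snoc.IH[rule_format, OF this]
    have last: "mc_step_ok V P (memory \<pi>) x"
      using snoc.prems[rule_format, of "length \<pi>"] by simp
    show ?case
    proof (cases x)
      case (Add p)
      then have "p \<in> mc_axioms V P \<or> mc_infers V P (set (lines \<pi>)) p"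
        using last mc_infers_mono[OF _ memory_subset_lines] by auto
      then show ?thesis
        using IH Add by (auto simp: nth_append less_Suc_eq)
    next
      case (Erase p)
      then show ?thesis using IH by simp
    qed
  qed simp
  then show ?thesis
    using assms by (simp add: mc_refutation_def)
qed

lemma lines_in_memory:
  assumes "p \<in> set (lines \<pi>)"
  shows "\<exists>k\<le>length \<pi>. p \<in> memory (take k \<pi>)"
  using assms
proof (induction \<pi> rule: rev_induct)
  case (snoc x \<pi>)
  show ?case
  proof (cases "p \<in> set (lines \<pi>)")
    case True
    then obtain k where "k \<le> length \<pi>" "p \<in> memory (take k \<pi>)"
      using snoc.IH by blast
    then show ?thesis by (intro exI[of _ k]) auto
  next
    case False
    then have "x = Add p"
      using snoc.prems by (cases x) auto
    then show ?thesis
      by (intro exI[of _ "Suc (length \<pi>)"]) auto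
  qed
qed simp

lemma finite_vars [simp]: "finite (vars p)"
  by (simp add: vars_def)

lemma finite_config_vars_memory: "finite (config_vars (memory \<pi>))"
  using finite_subset[OF memory_subset_lines[of \<pi>]] by (simp add: config_vars_def)

text \<open>Turns the recursive bounds into bounds at every prefix, which is the form used by the
  definitions of refutation, degree and variable space.\<close>

lemma admissible_memory:
  fixes \<pi> :: "('v, 'f::field) mpoly mc_step list"
  assumes "admissible V P s {} \<pi>"
  shows "(\<forall>k<length \<pi>. mc_step_ok V P (memory (take k \<pi>)) (\<pi> ! k)) \<and>
    (\<forall>k\<le>length \<pi>. card (config_vars (memory (take k \<pi>))) \<le> s) \<and>
    (\<forall>p\<in>set (lines \<pi>). total_degree p \<le> s)"
  using assms
proof (induction \<pi> rule: rev_induct)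
  case Nil
  then show ?case by (simp add: config_vars_def)
next
  case (snoc x \<pi>)
  then have x: "mc_step_ok V P (memory \<pi>) x" "\<forall>p. x = Add p \<longrightarrow> total_degree p \<le> s"
      "card (config_vars (apply_step x (memory \<pi>))) \<le> s"
    and IH: "\<forall>k<length \<pi>. mc_step_ok V P (memory (take k \<pi>)) (\<pi> ! k)"
      "\<forall>k\<le>length \<pi>. card (config_vars (memory (take k \<pi>))) \<le> s"
      "\<forall>p\<in>set (lines \<pi>). total_degree p \<le> s"
    by (simp_all add: admissible_append memory_def)
  have "\<forall>p\<in>set (lines (\<pi> @ [x])). total_degree p \<le> s"
    using x(2) IH(3) by (cases x) auto
  then show ?case
    using x IH by (auto simp: less_Suc_eq le_Suc_eq nth_append)
qed

text \<open>The arguments \<open>p\<close> and \<open>q\<close> are the last line before and after the derivation.\<close>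

definition derivation ::
    "'v set \<Rightarrow> ('v, 'f::field) mpoly set \<Rightarrow> nat \<Rightarrow> ('v, 'f) mpoly set \<Rightarrow> ('v, 'f) mpoly \<Rightarrow>
      ('v, 'f) mpoly set \<Rightarrow> ('v, 'f) mpoly \<Rightarrow> nat \<Rightarrow> bool" where
  "derivation V P s C p D q c \<longleftrightarrow>
     (\<exists>\<pi>. admissible V P s C \<pi> \<and> fold apply_step \<pi> C = D \<and> last (p # lines \<pi>) = q \<and>
       mc_size (lines \<pi>) \<le> c)"

lemma derivation_refl: "derivation V P s C p C p c"
  unfolding derivation_def by (intro exI[of _ "[]"]) (simp add: mc_size_def)

text \<open>Tracking the last line through \<open>p\<close>, \<open>p'\<close> and
  \<open>p''\<close> covers the case where the second piece adds no line and the last line of the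
  first one survives.\<close>

lemma derivation_trans:
  assumes "derivation V P s C p C' p' c" "derivation V P s C' p' C'' p'' c'"
  shows "derivation V P s C p C'' p'' (c + c')"
proof -
  obtain \<pi> where \<pi>: "admissible V P s C \<pi>" "fold apply_step \<pi> C = C'"
    "last (p # lines \<pi>) = p'" "mc_size (lines \<pi>) \<le> c"
    using assms(1) unfolding derivation_def by blast
  obtain \<rho> where \<rho>: "admissible V P s C' \<rho>" "fold apply_step \<rho> C' = C''"
    "last (p' # lines \<rho>) = p''" "mc_size (lines \<rho>) \<le> c'"
    using assms(2) unfolding derivation_def by blast
  have "last (p # lines (\<pi> @ \<rho>)) = p''"
    using \<pi>(3) \<rho>(3) by (auto split: if_splits)
  moreover have "mc_size (lines (\<pi> @ \<rho>)) \<le> c + c'"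
    using \<pi>(4) \<rho>(4) by (simp add: mc_size_def)
  ultimately show ?thesis
    unfolding derivation_def using \<pi> \<rho>
    by (intro exI[of _ "\<pi> @ \<rho>"]) (simp add: admissible_append)
qed

lemma derivation_weaken: "derivation V P s C p D q c \<Longrightarrow> c \<le> c' \<Longrightarrow> derivation V P s C p D q c'"
  unfolding derivation_def using le_trans by blast

text \<open>The set \<open>U\<close> is a finite cover of the variables in memory with at most
  \<open>s\<close> elements; it replaces computing the exact number of variables.\<close>

lemma derivation_add:
  assumes "q \<in> mc_axioms V P \<or> mc_infers V P C q" "total_degree q \<le> s"
    "finite U" "card U \<le> s" "config_vars (insert q C) \<subseteq> U"
  shows "derivation V P s C p (insert q C) q (num_monomials q)"
  unfolding derivation_def using assms card_mono[OF assms(3,5)]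
  by (intro exI[of _ "[Add q]"]) (auto simp: mc_size_def)

lemma derivation_erase:
  assumes "q \<in> C" "D = C - {q}" "finite U" "card U \<le> s" "config_vars C \<subseteq> U"
  shows "derivation V P s C p D p 0"
proof -
  have "config_vars D \<subseteq> U"
    using assms by (auto simp: config_vars_def)
  then show ?thesis
    unfolding derivation_def using assms card_mono[OF assms(3), of "config_vars D"]
    by (intro exI[of _ "[Erase q]"]) (auto simp: mc_size_def)
qed

text \<open>Multiplies \<open>f T\<close> by the variables of \<open>D\<close> one at a time,
  erasing each intermediate product once the next is present, with \<open>n\<close> monomials
  charged per new line. The set \<open>C\<close> stays in memory throughout. Taking \<open>f\<close>
  as a parameter serves monomials (\<open>n = 1\<close>) and binomials (\<open>n = 2\<close>)
  alike.\<close>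

lemma derivation_multiply_set:
  fixes f :: "'v set \<Rightarrow> ('v, 'f::field) mpoly"
  assumes "finite D" "D \<inter> T = {}" "D \<subseteq> V"
    and U: "finite U" "card U \<le> s" "config_vars C \<subseteq> U"
    and f: "\<And>A. T \<subseteq> A \<Longrightarrow> A \<subseteq> T \<union> D \<Longrightarrow> f A \<notin> C \<and> vars (f A) \<subseteq> U \<and> total_degree (f A) \<le> s \<and>
      num_monomials (f A) \<le> n \<and>
      (is_monomial (f A) \<or> (\<exists>m a. is_monomial m \<and> a \<in> mc_axioms V P \<and> f A = m * a))"
    and f_insert: "\<And>A a. T \<subseteq> A \<Longrightarrow> A \<subseteq> T \<union> D \<Longrightarrow> a \<in> D - A \<Longrightarrow>
      f (insert a A) = Var a * f A \<and> f (insert a A) \<noteq> f A"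
  shows "derivation V P s (insert (f T) C) (f T) (insert (f (T \<union> D)) C) (f (T \<union> D)) (n * card D)"
  using assms(1,2,3) f f_insert
proof (induction D rule: finite_induct)
  case empty
  then show ?case by (simp add: derivation_refl)
next
  case (insert a D)
  let ?C = "insert (f (T \<union> D)) C"
  let ?g = "f (insert a (T \<union> D))"
  have IH: "derivation V P s (insert (f T) C) (f T) ?C (f (T \<union> D)) (n * card D)"
  proof (rule insert.IH)
    show "D \<inter> T = {}" "D \<subseteq> V"
      using insert.prems by auto
    show "f A \<notin> C \<and> vars (f A) \<subseteq> U \<and> total_degree (f A) \<le> s \<and> num_monomials (f A) \<le> n \<and>
      (is_monomial (f A) \<or> (\<exists>m a. is_monomial m \<and> a \<in> mc_axioms V P \<and> f A = m * a))"
      if "T \<subseteq> A" "A \<subseteq> T \<union> D" for A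
      using that by (intro insert.prems(3)) auto
    show "f (insert b A) = Var b * f A \<and> f (insert b A) \<noteq> f A"
      if "T \<subseteq> A" "A \<subseteq> T \<union> D" "b \<in> D - A" for A b
      using that by (intro insert.prems(4)) auto
  qed
  have TD: "T \<subseteq> T \<union> D" "T \<union> D \<subseteq> T \<union> insert a D" by auto
  have TaD: "T \<subseteq> insert a (T \<union> D)" "insert a (T \<union> D) \<subseteq> T \<union> insert a D" by auto
  have g: "?g = Var a * f (T \<union> D)" "?g \<noteq> f (T \<union> D)"
    using insert.prems(4)[OF TD, of a] insert.hyps insert.prems(1) by auto
  have infers: "mc_infers V P ?C ?g"
    unfolding mc_infers_def
    using insert.prems(2) insert.prems(3)[OF TD] g(1) by blast
  have vars: "config_vars (insert ?g ?C) \<subseteq> U"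
    using insert.prems(3)[OF TD] insert.prems(3)[OF TaD] U(3) by (auto simp: config_vars_def)
  have "derivation V P s ?C (f (T \<union> D)) (insert ?g ?C) ?g (num_monomials ?g)"
    using infers insert.prems(3)[OF TaD] U(1,2) vars by (intro derivation_add) auto
  then have add: "derivation V P s ?C (f (T \<union> D)) (insert ?g ?C) ?g n"
    by (rule derivation_weaken) (use insert.prems(3)[OF TaD] in simp)
  \<comment> \<open>That \<open>f\<close> avoids \<open>C\<close> matters here: memory is a set, so
    an old product equal to an element of \<open>C\<close> would take that element with it.\<close>
  have "insert ?g ?C - {f (T \<union> D)} = insert ?g C"
    using g(2) insert.prems(3)[OF TD] by auto
  then have erase: "derivation V P s (insert ?g ?C) ?g (insert ?g C) ?g 0"
    using U(1,2) vars by (intro derivation_erase) auto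
  show ?case
    using derivation_trans[OF derivation_trans[OF IH add] erase] insert.hyps
    by (simp add: add.commute)
qed


section \<open>Pebbling moves as derivations\<close>

lemma derivation_multiply_monomial:
  fixes P :: "('v, 'f::field) mpoly set"
  assumes "finite B" "A \<subseteq> B" "B \<subseteq> V" "card B \<le> s"
    and C: "config_vars C \<subseteq> B" "\<And>T. A \<subseteq> T \<Longrightarrow> T \<subseteq> B \<Longrightarrow> set_monomial T \<notin> C"
  shows "derivation V P s (insert (set_monomial A) C) (set_monomial A)
    (insert (set_monomial B) C) (set_monomial B) (card B - card A)"
proof -
  have fin: "finite T" if "T \<subseteq> B" for T
    using that assms(1) finite_subset by blast
  have "derivation V P s (insert (set_monomial A) C) (set_monomial A)
    (insert (set_monomial (A \<union> (B - A))) C) (set_monomial (A \<union> (B - A))) (1 * card (B - A))"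
  proof (rule derivation_multiply_set[where U = B])
    show "finite (B - A)" "(B - A) \<inter> A = {}" "B - A \<subseteq> V" "finite B" "card B \<le> s"
      "config_vars C \<subseteq> B"
      using assms by auto
  next
    fix T assume "A \<subseteq> T" "T \<subseteq> A \<union> (B - A)"
    then have "T \<subseteq> B" "finite T" "A \<subseteq> T"
      using assms fin[of T] by auto
    then show "set_monomial T \<notin> C \<and> vars (set_monomial T :: ('v, 'f) mpoly) \<subseteq> B \<and>
        total_degree (set_monomial T :: ('v, 'f) mpoly) \<le> s \<and>
        num_monomials (set_monomial T :: ('v, 'f) mpoly) \<le> 1 \<and>
        (is_monomial (set_monomial T :: ('v, 'f) mpoly) \<or> (\<exists>m a. is_monomial m \<and>
          a \<in> mc_axioms V P \<and> set_monomial T = m * a))"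
      using assms card_mono[of B T] by (simp add: is_monomial_set_monomial)
  next
    fix T a assume "A \<subseteq> T" "T \<subseteq> A \<union> (B - A)" "a \<in> B - A - T"
    then have "finite T" "a \<notin> T"
      using assms fin[of T] by auto
    then show "(set_monomial (insert a T) :: ('v, 'f) mpoly) = Var a * set_monomial T \<and>
        (set_monomial (insert a T) :: ('v, 'f) mpoly) \<noteq> set_monomial T"
      by (auto simp: set_monomial_insert[symmetric] set_monomial_eq_iff)
  qed
  moreover have "A \<union> (B - A) = B" "card (B - A) = card B - card A"
    using assms by (auto simp: card_Diff_subset fin)
  ultimately show ?thesis by simp
qed

lemma derivation_undo_removal:
  fixes P :: "('v, 'f::field) mpoly set"
  assumes "finite A" "v \<in> V" "v \<notin> A" "A \<subseteq> V" "card (insert v A) \<le> s"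
  shows "derivation V P s {set_monomial A} (set_monomial A)
    {set_monomial (insert v A)} (set_monomial (insert v A)) 1"
  using derivation_multiply_monomial[of "insert v A" A V s "{}" P] assms
  by (auto simp: config_vars_def)

text \<open>The cost is 2 for the axiom of \<open>v\<close>, 2 for each factor in
  \<open>A - preds E v\<close>, and 1 for the final sum. Everything lives in the variables
  \<open>insert v A\<close>. The previous line \<open>p\<close> is arbitrary, since it may differ
  from the monomial in memory.\<close>

lemma derivation_undo_placement:
  fixes p :: "('v, 'f::field) mpoly"
  assumes "finite A" "v \<in> V" "v \<notin> A" "A \<subseteq> V" "preds E v \<subseteq> A" "card (insert v A) \<le> s"
  shows "derivation V (Peb V E z) s {set_monomial (insert v A)} p
    {set_monomial A} (set_monomial A) (2 * (card A - card (preds E v)) + 3)"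
proof -
  let ?P = "Peb V E z :: ('v, 'f) mpoly set"
  let ?m = "\<lambda>T. set_monomial T :: ('v, 'f) mpoly"
  let ?b = "\<lambda>T. set_binomial T v :: ('v, 'f) mpoly"
  let ?U = "insert v A"
  have fin: "finite T" if "T \<subseteq> A" for T
    using that assms(1) finite_subset by blast
  have finU: "finite ?U" using assms(1) by simp
  have vars_b: "vars (?b T) \<subseteq> ?U" if "T \<subseteq> A" for T
    using that fin[OF that] assms(3) by (subst vars_set_binomial) auto
  have degree_b: "total_degree (?b T) \<le> s" if "T \<subseteq> A" for T
    using that fin[OF that] assms card_mono[of A T] by (subst total_degree_set_binomial) auto
  have num_b: "num_monomials (?b T) = 2" if "T \<subseteq> A" for T
    using that fin[OF that] assms(3) by (subst num_monomials_set_binomial) auto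
  have b_neq: "?b T \<noteq> ?m T'" if "T \<subseteq> A" "finite T'" for T T'
    using that fin[OF that(1)] assms(3) by (intro set_binomial_neq_set_monomial) auto
  have axiom: "?b (preds E v) \<in> mc_axioms V ?P"
    using assms(2) by (auto simp: mc_axioms_def Peb_def peb_axiom_eq_set_binomial[symmetric])
  have "derivation V ?P s {?m ?U} p (insert (?b (preds E v)) {?m ?U}) (?b (preds E v))
      (num_monomials (?b (preds E v)))"
    using axiom degree_b vars_b assms
    by (intro derivation_add[where U = ?U]) (auto simp: config_vars_def)
  then have start: "derivation V ?P s {?m ?U} p {?b (preds E v), ?m ?U} (?b (preds E v)) 2"
    using num_b[OF assms(5)] by simp
  have "derivation V ?P s {?b (preds E v), ?m ?U} (?b (preds E v))
      {?b (preds E v \<union> (A - preds E v)), ?m ?U} (?b (preds E v \<union> (A - preds E v)))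
      (2 * card (A - preds E v))"
  proof (rule derivation_multiply_set[where U = ?U])
    show "finite (A - preds E v)" "(A - preds E v) \<inter> preds E v = {}" "A - preds E v \<subseteq> V"
      "finite ?U" "card ?U \<le> s" "config_vars {?m ?U} \<subseteq> ?U"
      using assms by (auto simp: config_vars_def)
  next
    fix T assume T: "preds E v \<subseteq> T" "T \<subseteq> preds E v \<union> (A - preds E v)"
    then have "T \<subseteq> A"
      using assms(5) by blast
    have "finite (T - preds E v)"
      using fin[OF \<open>T \<subseteq> A\<close>] by simp
    moreover have "peb_axiom E v \<in> mc_axioms V ?P"
      using axiom by (simp add: peb_axiom_eq_set_binomial)
    ultimately have "\<exists>m a. is_monomial m \<and> a \<in> mc_axioms V ?P \<and> ?b T = m * a"
      using set_binomial_multiple_of_axiom[OF fin[OF \<open>T \<subseteq> A\<close>] T(1)] is_monomial_set_monomial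
      by blast
    then show "?b T \<notin> {?m ?U} \<and> vars (?b T) \<subseteq> ?U \<and> total_degree (?b T) \<le> s \<and>
        num_monomials (?b T) \<le> 2 \<and>
        (is_monomial (?b T) \<or> (\<exists>m a. is_monomial m \<and> a \<in> mc_axioms V ?P \<and> ?b T = m * a))"
      using b_neq[OF \<open>T \<subseteq> A\<close> finU] vars_b[OF \<open>T \<subseteq> A\<close>] degree_b[OF \<open>T \<subseteq> A\<close>] num_b[OF \<open>T \<subseteq> A\<close>]
      by simp
  next
    fix T a
    assume T: "preds E v \<subseteq> T" "T \<subseteq> preds E v \<union> (A - preds E v)" "a \<in> A - preds E v - T"
    then have TA: "T \<subseteq> A" "insert a T \<subseteq> A" "a \<notin> T"
      using assms(5) by auto
    \<comment> \<open>The two binomials differ because \<open>a\<close> occurs in only one of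
      them.\<close>
    have "a \<in> vars (?b (insert a T)) - vars (?b T)"
      using T(3) TA assms(3) fin by (subst (1 2) vars_set_binomial) auto
    then show "?b (insert a T) = Var a * ?b T \<and> ?b (insert a T) \<noteq> ?b T"
      using set_binomial_insert[OF fin[OF TA(1)] TA(3)] by (metis DiffD1 DiffD2)
  qed
  moreover have "preds E v \<union> (A - preds E v) = A"
    "card (A - preds E v) = card A - card (preds E v)"
    using assms by (auto simp: card_Diff_subset fin)
  ultimately have grow: "derivation V ?P s {?b (preds E v), ?m ?U} (?b (preds E v))
      {?b A, ?m ?U} (?b A) (2 * (card A - card (preds E v)))"
    by simp
  have vars: "config_vars {?m A, ?b A, ?m ?U} \<subseteq> ?U"
    using assms by (auto simp: config_vars_def)
  \<comment> \<open>The term containing \<open>v\<close> cancels: \<open>?b A\<close> is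
    \<open>?m A - ?m ?U\<close>.\<close>
  have "?m A = Const 1 * ?m ?U + Const 1 * ?b A"
    using assms by (simp add: set_binomial_eq Const_def flip: one_poly_mapping_def)
  then have "mc_infers V ?P {?b A, ?m ?U} (?m A)"
    unfolding mc_infers_def by blast
  then have "derivation V ?P s {?b A, ?m ?U} (?b A) {?m A, ?b A, ?m ?U} (?m A)
      (num_monomials (?m A))"
    using vars assms by (intro derivation_add[where U = ?U]) auto
  then have add: "derivation V ?P s {?b A, ?m ?U} (?b A) {?m A, ?b A, ?m ?U} (?m A) 1"
    using assms by simp
  have m_neq: "?m A \<noteq> ?m ?U"
    using assms by (subst set_monomial_eq_iff) auto
  have "derivation V ?P s {?m A, ?b A, ?m ?U} (?m A) {?m A, ?m ?U} (?m A) 0"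
    using vars assms b_neq[of A A] b_neq[of A ?U]
    by (intro derivation_erase[where q = "?b A" and U = ?U]) auto
  moreover have "derivation V ?P s {?m A, ?m ?U} (?m A) {?m A} (?m A) 0"
    using vars assms m_neq
    by (intro derivation_erase[where q = "?m ?U" and U = ?U]) (auto simp: config_vars_def)
  ultimately have erase: "derivation V ?P s {?m A, ?b A, ?m ?U} (?m A) {?m A} (?m A) (0 + 0)"
    by (rule derivation_trans)
  show ?thesis
    by (rule derivation_weaken[OF derivation_trans[OF derivation_trans[OF derivation_trans[OF
          start grow] add] erase]]) simp
qed

text \<open>Starting from the axiom \<open>Var z\<close>, one monomial is written for each variable
  of \<open>W\<close>, hence \<open>s\<close> in total, and the product over \<open>A\<close> is
  passed on the way and kept. The initial \<open>0\<close> is a placeholder for a missing previous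
  line.\<close>

lemma derivation_pebbled_monomial:
  assumes "z \<in> A" "A \<subseteq> W" "W \<subseteq> V" "finite W" "card W = s"
  shows "derivation V (Peb V E z :: ('v, 'f::field) mpoly set) s {} 0
    {set_monomial W, set_monomial A} (set_monomial W) s"
proof -
  let ?P = "Peb V E z :: ('v, 'f) mpoly set"
  let ?m = "\<lambda>T. set_monomial T :: ('v, 'f) mpoly"
  have finA: "finite A"
    using assms finite_subset by blast
  have cards: "1 \<le> card A" "card A \<le> s"
    using assms finA card_mono[of W A] by (auto simp: Suc_le_eq card_gt_0_iff)
  have z: "?m {z} = Var z"
    by (simp add: set_monomial_def)
  then have "?m {z} \<in> mc_axioms V ?P"
    by (simp add: mc_axioms_def Peb_def)
  then have "derivation V ?P s {} 0 {?m {z}} (?m {z}) (num_monomials (?m {z}))"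
    using cards by (intro derivation_add[where U = "{z}"]) (auto simp: config_vars_def)
  then have start: "derivation V ?P s {} 0 {?m {z}} (?m {z}) 1"
    by simp
  have "derivation V ?P s {?m {z}} (?m {z}) {?m A} (?m A) (card A - card {z})"
    using assms finA cards by (intro derivation_multiply_monomial) (auto simp: config_vars_def)
  note to_A = derivation_trans[OF start this]
  show ?thesis
  proof (cases "A = W")
    case True
    then show ?thesis
      using to_A assms cards by simp
  next
    case False
    then obtain w where w: "w \<in> W" "w \<notin> A"
      using assms(2) by blast
    let ?A = "insert w A"
    have A: "?A \<subseteq> W" "finite ?A"
      using w assms(2) finA by auto
    have "card ?A \<le> s"
      using card_mono[OF assms(4) A(1)] assms(5) by simp
    \<comment> \<open>The first factor beyond \<open>A\<close> is added by hand, without an erasure,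
      so that \<open>?m A\<close> stays in memory; from then on it plays the role of the fixed set
      \<open>C\<close>.\<close>
    have "mc_infers V ?P {?m A} (?m ?A)"
      unfolding mc_infers_def
      using finA w assms by (auto simp: set_monomial_insert is_monomial_set_monomial)
    then have "derivation V ?P s {?m A} (?m A) {?m ?A, ?m A} (?m ?A) (num_monomials (?m ?A))"
      using A finA \<open>card ?A \<le> s\<close>
      by (intro derivation_add[where U = ?A]) (auto simp: config_vars_def)
    then have add: "derivation V ?P s {?m A} (?m A) {?m ?A, ?m A} (?m ?A) 1"
      using finA by simp
    have "?m T \<notin> {?m A}" if "?A \<subseteq> T" "T \<subseteq> W" for T
      using that w finA finite_subset[OF that(2) assms(4)] by (auto simp: set_monomial_eq_iff)
    then have "derivation V ?P s {?m ?A, ?m A} (?m ?A) {?m W, ?m A} (?m W) (card W - card ?A)"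
      using assms A finA by (intro derivation_multiply_monomial) (auto simp: config_vars_def)
    note all = derivation_trans[OF derivation_trans[OF to_A add] this]
    show ?thesis
      by (rule derivation_weaken[OF all])
        (use cards w finA \<open>card ?A \<le> s\<close> assms(5) in simp)
  qed
qed


section \<open>Black pebblings\<close>

text \<open>In a finite DAG every vertex reaches a sink, here \<open>z\<close>, and a path into a
  vertex without predecessors has length 0. This isolates the exceptional case of the size
  bound.\<close>

lemma unique_sink_source:
  assumes "dag_with_sink V E z" "preds E z = {}"
  shows "V = {z}"
proof -
  have E: "E \<subseteq> V \<times> V" "acyclic E" "finite V" and sink: "{v \<in> V. \<forall>w. (v, w) \<notin> E} = {z}"
    using assms(1) by (auto simp: dag_with_sink_def)
  then have "wf (E\<inverse>)"
    using finite_subset[of E "V \<times> V"] by (intro finite_acyclic_wf_converse) auto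
  have "(v, z) \<in> E\<^sup>*" if "v \<in> V" for v
    using \<open>wf (E\<inverse>)\<close> that
  proof (induction v rule: wf_induct_rule)
    case (less v)
    show ?case
    proof (cases "v = z")
      case False
      then obtain w where "(v, w) \<in> E"
        using sink less.prems by blast
      then show ?thesis
        using less.IH[of w] E(1) by (auto intro: converse_rtrancl_into_rtrancl)
    qed simp
  qed
  moreover have "v = z" if "(v, z) \<in> E\<^sup>*" for v
    using that assms(2) by (auto simp: preds_def elim: rtranclE)
  ultimately show ?thesis
    using sink by blast
qed

lemma pebbling_move_cases:
  assumes "pebbling_move V E B B'"
  obtains (place) v where "v \<in> V" "v \<notin> B" "preds E v \<subseteq> B" "B' = insert v B"
  | (remove) v where "v \<notin> B'" "B = insert v B'"
  using assms unfolding pebbling_move_def by blast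

section \<open>Counting pebbles along a strategy\<close>

lemma pebbling_subset:
  assumes "black_pebbling V E z B t" "j \<le> t"
  shows "B j \<subseteq> V"
  using assms(2)
proof (induction j)
  case 0
  then show ?case using assms(1) by (simp add: black_pebbling_def)
next
  case (Suc j)
  then have "pebbling_move V E (B j) (B (Suc j))"
    using assms(1) by (simp add: black_pebbling_def)
  then show ?case
    using Suc by (auto simp: pebbling_move_def)
qed

text \<open>Every move changes the number of pebbles by exactly one. For \<open>j = t\<close> this
  makes \<open>t\<close> even, which rules out \<open>t = 3\<close> in the one-vertex case.\<close>

lemma pebbling_parity:
  assumes "black_pebbling V E z B t" "finite V" "j \<le> t"
  shows "even (card (B j) + j)"
  using assms(3)
proof (induction j)
  case 0
  then show ?case using assms(1) by (simp add: black_pebbling_def)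
next
  case (Suc j)
  then have move: "pebbling_move V E (B j) (B (Suc j))"
    using assms(1) by (simp add: black_pebbling_def)
  have fin: "finite (B j)" "finite (B (Suc j))"
    using pebbling_subset[OF assms(1)] assms(2) Suc.prems finite_subset
    by (meson Suc_leD)+
  have "even (card (B j) + j)"
    using Suc by simp
  with move show ?case
    by (cases rule: pebbling_move_cases) (use fin in auto)
qed

text \<open>A move removes at most one pebble, and the board must be empty at time
  \<open>t\<close>.\<close>

lemma pebbling_card_le_remaining_time:
  assumes "black_pebbling V E z B t" "finite V" "j \<le> t"
  shows "card (B j) \<le> t - j"
  using assms(3)
proof (induction j rule: inc_induct)
  case base
  then show ?case using assms(1) by (simp add: black_pebbling_def)
next
  case (step j)
  then have move: "pebbling_move V E (B j) (B (Suc j))"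
    using assms(1) by (simp add: black_pebbling_def)
  have fin: "finite (B j)" "finite (B (Suc j))"
    using pebbling_subset[OF assms(1)] assms(2) step.hyps finite_subset
    by (meson less_imp_le Suc_leI)+
  from move show ?case
    by (cases rule: pebbling_move_cases) (use fin step in auto)
qed

text \<open>
  A source that is pebbled at full space \<open>s\<close> would cost \<open>2 * s + 1\<close> monomials, which is too much.
  The next move is then a removal, and performing it first makes the placement cheaper. So the
  induction goes through the configurations with fewer than \<open>s\<close> pebbles only.
\<close>

lemma derivation_pebbling_prefix:
  assumes dag: "dag_with_sink V E z" and peb: "black_pebbling V E z B t"
    and space: "\<And>j. j \<le> t \<Longrightarrow> card (B j) \<le> s"
    and "j \<le> t" "card (B j) < s"
  shows "\<exists>c. derivation V (Peb V E z :: ('v, 'f::field) mpoly set) s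
      {set_monomial (B j)} (set_monomial (B j)) {1} 1 c \<and> c + card (B j) \<le> s * (j + card (B j))"
  using assms(4,5)
proof (induction j rule: less_induct)
  case (less j)
  let ?D = "derivation V (Peb V E z :: ('v, 'f) mpoly set) s"
  let ?m = "\<lambda>T. set_monomial T :: ('v, 'f) mpoly"
  have V: "finite V"
    using dag by (simp add: dag_with_sink_def)
  have sub: "B k \<subseteq> V" if "k \<le> t" for k
    using pebbling_subset[OF peb that] .
  have fin: "finite (B k)" if "k \<le> t" for k
    using sub[OF that] V finite_subset by blast
  have step: "pebbling_move V E (B k) (B (Suc k))" if "k < t" for k
    using peb that by (simp add: black_pebbling_def)
  show ?case
  proof (cases j)
    case 0
    then have "B j = {}"
      using peb by (simp add: black_pebbling_def)
    then show ?thesis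
      by (auto intro!: exI[of _ 0] derivation_refl)
  next
    case (Suc k)
    then have k: "k < t" "k \<le> t" "k < j"
      using less.prems by auto
    from step[OF k(1)] show ?thesis
    proof (cases rule: pebbling_move_cases)
      case (place v)
      then have card_j: "card (B j) = Suc (card (B k))"
        using fin[OF k(2)] Suc by simp
      then obtain c where c: "?D {?m (B k)} (?m (B k)) {1} 1 c"
        "c + card (B k) \<le> s * (k + card (B k))"
        using less.IH[OF k(3,2)] less.prems by auto
      have "?D {?m (insert v (B k))} (?m (B j)) {?m (B k)} (?m (B k))
          (2 * (card (B k) - card (preds E v)) + 3)"
        using place sub[OF k(2)] fin[OF k(2)] less.prems card_j Suc
        by (intro derivation_undo_placement) auto
      then have "?D {?m (B j)} (?m (B j)) {?m (B k)} (?m (B k))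
          (2 * (card (B k) - card (preds E v)) + 3)"
        using place Suc by simp
      note derivation_trans[OF this c(1)]
      moreover have "2 * (card (B k) - card (preds E v)) + 3 + c + card (B j)
          \<le> s * (j + card (B j))"
      proof -
        \<comment> \<open>A placement raises \<open>j + card (B j)\<close> by 2, which releases
          \<open>2 * s\<close>. This suffices because \<open>card (B k) + 2\<close> is at most
          \<open>s\<close>, so that \<open>2 * card (B k) + 4\<close> is at most
          \<open>2 * s\<close>.\<close>
        have "2 * (card (B k) - card (preds E v)) + 3 + c + card (B j) \<le>
            2 * s + s * (k + card (B k))"
          using c(2) card_j less.prems by linarith
        also have "\<dots> = s * (j + card (B j))"
          using card_j Suc by (simp add: algebra_simps)
        finally show ?thesis .
      qed
      ultimately show ?thesis by blast
    next
      case (remove u)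
      then have Bk: "B k = insert u (B j)" "u \<notin> B j"
        using Suc by auto
      then have card_k: "card (B k) = Suc (card (B j))"
        using fin[OF less.prems(1)] by simp
      have u: "u \<in> V"
        using sub[OF k(2)] Bk by auto
      show ?thesis
      proof (cases "card (B k) < s")
        case True
        then obtain c where c: "?D {?m (B k)} (?m (B k)) {1} 1 c"
          "c + card (B k) \<le> s * (k + card (B k))"
          using less.IH[OF k(3,2)] by auto
        have "?D {?m (B j)} (?m (B j)) {?m (B k)} (?m (B k)) 1"
          using derivation_undo_removal[of "B j" u V s] fin less.prems u Bk sub space k(2) by auto
        note derivation_trans[OF this c(1)]
        \<comment> \<open>A removal leaves \<open>j + card (B j)\<close> unchanged; the one monomial
          is paid by the drop of the summand \<open>card (B j)\<close> on the left.\<close>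
        moreover have "1 + c + card (B j) \<le> s * (j + card (B j))"
          using c(2) card_k Suc by simp
        ultimately show ?thesis by blast
      next
        case False
        then have full: "card (B k) = s" "Suc (card (B j)) = s"
          using card_k space[OF k(2)] by auto
        have "k \<noteq> 0"
          using full peb by (cases k) (auto simp: black_pebbling_def)
        then obtain i where i: "k = Suc i"
          by (cases k) auto
        then have it: "i < t" "i \<le> t" "i < j"
          using k by auto
        \<comment> \<open>A removal leading to the full configuration \<open>B k\<close> would need
          \<open>s + 1\<close> pebbles before it.\<close>
        obtain v where v: "v \<in> V" "v \<notin> B i" "preds E v \<subseteq> B i" "B k = insert v (B i)"
          using step[OF it(1)]
        proof (cases rule: pebbling_move_cases)
          case place
          then show ?thesis using that i by simp
        next
          case (remove w)
          then have "card (B i) = Suc s"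
            using full(1) fin[OF k(2)] i by simp
          then show ?thesis
            using space[OF it(2)] by simp
        qed
        then have card_i: "card (B i) = card (B j)"
          using full fin[OF it(2)] by simp
        then obtain c where c: "?D {?m (B i)} (?m (B i)) {1} 1 c"
          "c + card (B i) \<le> s * (i + card (B i))"
          using less.IH[OF it(3,2)] less.prems by auto
        \<comment> \<open>Both moves together have a budget of \<open>2 * s\<close>, as
          \<open>j = i + 2\<close> and the numbers of pebbles agree.\<close>
        have bound: "2 * s + c + card (B j) \<le> s * (j + card (B j))"
          using c(2) card_i i Suc by simp
        \<comment> \<open>If \<open>u = v\<close>, the two moves cancel. If \<open>v\<close> is a
          source, they are swapped, passing through the common part \<open>A\<close> with
          \<open>s - 2\<close> pebbles: \<open>2 * (s - 2) + 3\<close> and then 1. Otherwise they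
          are undone in order; a nonempty \<open>preds E v\<close> lowers the cost to at most
          \<open>1 + 2 * (s - 2) + 3\<close>.\<close>
        have "?D {?m (B j)} (?m (B j)) {?m (B i)} (?m (B i)) (2 * s)"
        proof (cases "u = v")
          case True
          then have "B i = B j"
            using Bk v by (auto simp: set_eq_iff)
          then show ?thesis
            by (simp add: derivation_refl)
        next
          case False
          show ?thesis
          proof (cases "preds E v = {}")
            case True
            have swap: "insert u (B j) = insert v (B i)"
              by (rule trans[OF Bk(1)[symmetric] v(4)])
            define A where "A = B j - {v}"
            have "v \<in> B j"
              using swap False by (metis insertE insertI1)
            then have A: "B j = insert v A" "u \<notin> A" "v \<notin> A"
              using Bk(2) by (simp_all add: A_def insert_absorb)
            have "B i = insert u (B j) - {v}"
              using swap v(2) by simp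
            then have Bi: "B i = insert u A"
              unfolding A_def using False by (simp add: insert_Diff_if)
            have "finite A" "A \<subseteq> V"
              using fin[OF less.prems(1)] sub[OF less.prems(1)] unfolding A_def by auto
            have card_A: "Suc (Suc (card A)) = s"
              using A \<open>finite A\<close> full(2) by simp
            have "?D {?m (insert v A)} (?m (B j)) {?m A} (?m A)
                (2 * (card A - card (preds E v)) + 3)"
              using A(3) True v(1) card_A \<open>finite A\<close> \<open>A \<subseteq> V\<close>
              by (intro derivation_undo_placement) auto
            then have place: "?D {?m (B j)} (?m (B j)) {?m A} (?m A)
                (2 * (card A - card (preds E v)) + 3)"
              using A(1) by simp
            have "?D {?m A} (?m A) {?m (insert u A)} (?m (insert u A)) 1"
              using A(2) u card_A \<open>finite A\<close> \<open>A \<subseteq> V\<close>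
              by (intro derivation_undo_removal) auto
            then have "?D {?m A} (?m A) {?m (B i)} (?m (B i)) 1"
              using Bi by simp
            note derivation_trans[OF place this]
            then show ?thesis
              by (rule derivation_weaken) (use card_A in simp)
          next
            case nonempty: False
            have "finite (preds E v)"
              using v(3) fin[OF it(2)] finite_subset by blast
            then have "card (preds E v) > 0" "card (preds E v) \<le> card (B i)"
              using nonempty v(3) fin[OF it(2)] by (auto simp: card_gt_0_iff intro: card_mono)
            have undo: "?D {?m (B j)} (?m (B j)) {?m (B k)} (?m (B k)) 1"
              using derivation_undo_removal[of "B j" u V s] fin less.prems u Bk sub full by auto
            have "?D {?m (insert v (B i))} (?m (B k)) {?m (B i)} (?m (B i))
                (2 * (card (B i) - card (preds E v)) + 3)"
              using v sub[OF it(2)] fin[OF it(2)] full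
              by (intro derivation_undo_placement) auto
            then have "?D {?m (B k)} (?m (B k)) {?m (B i)} (?m (B i))
                (2 * (card (B i) - card (preds E v)) + 3)"
              using v(4) by simp
            note derivation_trans[OF undo this]
            then show ?thesis
              by (rule derivation_weaken)
                (use \<open>card (preds E v) > 0\<close> \<open>card (preds E v) \<le> card (B i)\<close> card_i full
                  in simp)
          qed
        qed
        note derivation_trans[OF this c(1)]
        then show ?thesis using bound by blast
      qed
    qed
  qed
qed

section \<open>Assembling the refutation\<close>

theorem theorem3p1:
  fixes V :: "'v set" and E :: "'v rel" and z :: 'v
    and B :: "nat \<Rightarrow> 'v set" and t s :: nat
  assumes "dag_with_sink V E z"
    and "black_pebbling V E z B t"
    and "pebbling_space B t = s"
  shows "\<exists>\<pi> :: ('v, 'f::field) mpoly mc_step list.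
           mc_refutation V (Peb V E z) (lines \<pi>) \<and>
           mc_config_refutation V (Peb V E z) \<pi> \<and>
           mc_degree (lines \<pi>) = s \<and>
           mc_size (lines \<pi>) \<le> (if V = {z} \<and> t = 2 then 4 else t * s) \<and>
           mc_variable_space \<pi> = mc_degree (lines \<pi>)"
proof -
  let ?P = "Peb V E z :: ('v, 'f) mpoly set"
  let ?m = "\<lambda>T. set_monomial T :: ('v, 'f) mpoly"
  let ?bound = "if V = {z} \<and> t = 2 then 4 else t * s"
  have V: "finite V"
    using assms(1) by (auto simp: dag_with_sink_def)
  have sub: "B j \<subseteq> V" if "j \<le> t" for j
    using pebbling_subset[OF assms(2) that] .
  have fin: "finite (B j)" if "j \<le> t" for j
    using sub[OF that] V finite_subset by blast
  have space: "card (B j) \<le> s" if "j \<le> t" for j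
    using assms(3) that unfolding pebbling_space_def by (metis Max_ge atMost_iff finite_atMost
        finite_imageI image_eqI)
  have "s \<in> (\<lambda>j. card (B j)) ` {..t}"
    unfolding assms(3)[symmetric] pebbling_space_def by (rule Max_in) auto
  then have "s \<le> card V"
    using card_mono[OF V sub] by auto
  define i where "i = (LEAST i. z \<in> B i)"
  have B0: "B 0 = {}" and "\<exists>i\<le>t. z \<in> B i"
    using assms(2) by (auto simp: black_pebbling_def)
  then have i: "z \<in> B i" "i \<le> t"
    unfolding i_def by (auto intro: LeastI Least_le order_trans)
  then obtain k where k: "i = Suc k"
    using B0 by (cases i) auto
  then have "z \<notin> B k" "k < t" "k \<le> t"
    using i not_less_Least[of k "\<lambda>i. z \<in> B i"] unfolding i_def by auto
  then have "pebbling_move V E (B k) (B i)"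
    using assms(2) k by (simp add: black_pebbling_def)
  then have Bi: "z \<in> V" "preds E z \<subseteq> B k" "B i = insert z (B k)"
    using \<open>z \<notin> B k\<close> i(1) by (auto simp: pebbling_move_def)
  have card_i: "card (B i) = Suc (card (B k))"
    using Bi(3) \<open>z \<notin> B k\<close> fin[OF \<open>k \<le> t\<close>] by simp
  \<comment> \<open>\<open>W\<close> pads \<open>B i\<close> to exactly \<open>s\<close> vertices,
    which \<open>V\<close> has because the space \<open>s\<close> is attained by a configuration.
    The line \<open>?m W\<close> is what makes degree and variable space reach
    \<open>s\<close>.\<close>
  obtain W where W: "B i \<subseteq> W" "W \<subseteq> V" "card W = s"
    using exists_subset_between[OF space[OF i(2)] \<open>s \<le> card V\<close> sub[OF i(2)] V] by blast
  then have "finite W"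
    using V finite_subset by blast
  have start: "derivation V ?P s {} 0 {?m W, ?m (B i)} (?m W) s"
    using W i \<open>finite W\<close> by (intro derivation_pebbled_monomial) auto
  \<comment> \<open>If \<open>W = B i\<close>, both names denote one polynomial and nothing may be
    erased.\<close>
  have forget: "derivation V ?P s {?m W, ?m (B i)} (?m W) {?m (B i)} (?m W) 0"
  proof (cases "W = B i")
    case True
    then show ?thesis by (simp add: derivation_refl)
  next
    case False
    then have "?m W \<noteq> ?m (B i)"
      using \<open>finite W\<close> fin[OF i(2)] by (simp add: set_monomial_eq_iff)
    then show ?thesis
      using W \<open>finite W\<close> fin[OF i(2)]
      by (intro derivation_erase[where q = "?m W" and U = W]) (auto simp: config_vars_def)
  qed
  have "derivation V ?P s {?m (insert z (B k))} (?m W) {?m (B k)} (?m (B k))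
      (2 * (card (B k) - card (preds E z)) + 3)"
    using Bi \<open>z \<notin> B k\<close> fin[OF \<open>k \<le> t\<close>] sub[OF \<open>k \<le> t\<close>] space[OF i(2)]
    by (intro derivation_undo_placement) auto
  then have unpebble: "derivation V ?P s {?m (B i)} (?m W) {?m (B k)} (?m (B k))
      (2 * (card (B k) - card (preds E z)) + 3)"
    using Bi(3) by simp
  have "card (B k) < s"
    using card_i space[OF i(2)] by simp
  obtain c where c: "derivation V ?P s {?m (B k)} (?m (B k)) {1} 1 c"
    and size: "s + 2 * (card (B k) - card (preds E z)) + 3 + c \<le> ?bound"
  proof (cases "preds E z = {}")
    case True
    then have "V = {z}"
      by (rule unique_sink_source[OF assms(1)])
    then have Bk: "B k = {}"
      using sub[OF \<open>k \<le> t\<close>] \<open>z \<notin> B k\<close> by auto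
    have s: "s = 1"
      using \<open>s \<le> card V\<close> \<open>V = {z}\<close> \<open>card (B k) < s\<close> by simp
    have "i + card (B i) \<le> t"
      using pebbling_card_le_remaining_time[OF assms(2) V i(2)] i(2) by simp
    then have "t \<ge> 2"
      using k card_i by simp
    moreover have "even t"
      using pebbling_parity[OF assms(2) V order_refl] assms(2)
      by (simp add: black_pebbling_def)
    ultimately have "t = 2 \<or> t \<ge> 4"
      by presburger
    \<comment> \<open>The left side is \<open>1 + 0 + 3 + 0 = 4\<close>: the exceptional bound for
      \<open>t = 2\<close>, and at most \<open>t * s\<close> for \<open>t\<close> at least
      4.\<close>
    then have "s + 2 * (card (B k) - card (preds E z)) + 3 + 0 \<le> ?bound"
      using s Bk \<open>V = {z}\<close> by auto
    then show ?thesis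
      using that[of 0] Bk by (simp add: derivation_refl)
  next
    case False
    then have preds: "card (preds E z) > 0" "card (preds E z) \<le> card (B k)"
      using Bi(2) fin[OF \<open>k \<le> t\<close>] finite_subset[OF Bi(2)] card_mono by (auto simp: card_gt_0_iff)
    have "V \<noteq> {z}"
      using preds Bi(2) sub[OF \<open>k \<le> t\<close>] \<open>z \<notin> B k\<close> False by auto
    obtain c where c: "derivation V ?P s {?m (B k)} (?m (B k)) {1} 1 c"
      "c + card (B k) \<le> s * (k + card (B k))"
      using derivation_pebbling_prefix[OF assms(1,2) space \<open>k \<le> t\<close> \<open>card (B k) < s\<close>] by blast
    \<comment> \<open>Since \<open>preds E z\<close> is nonempty, undoing the placement costs at
      most \<open>2 * card (B k) + 1\<close>. The induction bound on \<open>c\<close> absorbs one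
      \<open>card (B k)\<close>, and \<open>card (B k) + 1\<close> is at most
      \<open>s\<close>.\<close>
    have "s + 2 * (card (B k) - card (preds E z)) + 3 + c \<le> 2 * s + s * (k + card (B k))"
      using c(2) preds \<open>card (B k) < s\<close> by linarith
    also have "\<dots> = s * (i + card (B i))"
      using k card_i by (simp add: algebra_simps)
    also have "\<dots> \<le> s * t"
      using pebbling_card_le_remaining_time[OF assms(2) V i(2)] i(2) by (intro mult_le_mono2) simp
    finally show ?thesis
      using that[OF c(1)] \<open>V \<noteq> {z}\<close> by (simp add: mult.commute)
  qed
  obtain \<pi> where \<pi>: "admissible V ?P s {} \<pi>" "fold apply_step \<pi> {} = {?m W, ?m (B i)}"
    "last (0 # lines \<pi>) = ?m W" "mc_size (lines \<pi>) \<le> s"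
    using start unfolding derivation_def by blast
  obtain \<rho> where \<rho>: "admissible V ?P s {?m W, ?m (B i)} \<rho>"
    "fold apply_step \<rho> {?m W, ?m (B i)} = {1}" "last (?m W # lines \<rho>) = 1"
    "mc_size (lines \<rho>) \<le> 2 * (card (B k) - card (preds E z)) + 3 + c"
    using derivation_trans[OF derivation_trans[OF forget unpebble] c] unfolding derivation_def
    by auto
  let ?\<pi> = "\<pi> @ \<rho>"
  have "num_monomials (0 :: ('v, 'f) mpoly) = 0"
    by (simp add: num_monomials_def)
  \<comment> \<open>This excludes that \<open>?m W\<close> is only the placeholder \<open>0\<close>,
    so it is a genuine line of the first piece.\<close>
  then have "?m W \<noteq> 0"
    using num_monomials_set_monomial[OF \<open>finite W\<close>] by (metis zero_neq_one)
  then have W_line: "?m W \<in> set (lines \<pi>)"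
    using \<pi>(3) by (metis last.simps last_in_set)
  have adm: "admissible V ?P s {} ?\<pi>"
    using \<pi>(1,2) \<rho>(1) by (simp add: admissible_append)
  note adm_memory = admissible_memory[OF adm]
  have config: "mc_config_refutation V ?P ?\<pi>"
    unfolding mc_config_refutation_def using adm_memory \<pi>(2) \<rho>(2) by (simp add: memory_def)
  moreover have "mc_refutation V ?P (lines ?\<pi>)"
    using W_line \<pi>(3) \<rho>(3) by (intro mc_refutation_lines config) (auto split: if_splits)
  moreover have degree: "mc_degree (lines ?\<pi>) = s"
    unfolding mc_degree_def
  proof (rule Max_eqI)
    show "s \<in> total_degree ` set (lines ?\<pi>)"
      using W_line W(3) total_degree_set_monomial[OF \<open>finite W\<close>, where 'f = 'f]
      by (metis UnCI image_eqI lines_simps(4) set_append)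
  qed (use adm_memory in auto)
  moreover have "mc_size (lines ?\<pi>) \<le> ?bound"
    using \<pi>(4) \<rho>(4) size by (simp add: mc_size_def)
  moreover have "mc_variable_space ?\<pi> = s"
    unfolding mc_variable_space_def config_vars_def[symmetric]
  proof (rule Max_eqI)
    \<comment> \<open>The maximum is attained at a moment when \<open>?m W\<close> is in memory;
      admissibility gives the upper bound.\<close>
    obtain l where l: "l \<le> length ?\<pi>" "?m W \<in> memory (take l ?\<pi>)"
      using lines_in_memory[of "?m W" ?\<pi>] W_line by auto
    then have "W \<subseteq> config_vars (memory (take l ?\<pi>))"
      using vars_set_monomial[OF \<open>finite W\<close>, where 'f = 'f] by (auto simp: config_vars_def)
    then have "s \<le> card (config_vars (memory (take l ?\<pi>)))"
      using card_mono[OF finite_config_vars_memory] W(3) by blast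
    then have "card (config_vars (memory (take l ?\<pi>))) = s"
      using adm_memory l(1) by (meson le_antisym)
    then show "s \<in> (\<lambda>k. card (config_vars (memory (take k ?\<pi>)))) ` {..length ?\<pi>}"
      using l(1) by force
  qed (use adm_memory in auto)
  ultimately show ?thesis
    by (intro exI[of _ ?\<pi>]) simp
qed

end
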